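(* Let $H$ be a $3$-uniform hypergraph on $n$ vertices ($n$ finite) containing no linear cycle. Then $\alpha(H)\ge \frac{2}{5}n$.
   Context: A $3$-uniform hypergraph $H=(V,E)$ consists of a vertex set $V$ and a set $E$ of $3$-element subsets of $V$ (edges). A linear cycle in $H$ is a set of $k\ge 3$ edges of the form $\{v_i,w_i,v_{i+1}\}$, $i=1,\dots,k$ (indices modulo $k$), where $v_1,\dots,v_k,w_1,\dots,w_k$ are $2k$ distinct vertices. Thus only cyclically consecutive edges intersect, they intersect in exactly one vertex, and these intersection vertices are distinct. A set $S\subseteq V$ is independent if no edge of $H$ is contained in $S$; $\alpha(H)$ is the maximum cardinality of an independent set of $H$. *)

theory Defs
  imports Complex_Main
begin

definition three_uniform_hypergraph :: "'a set \<Rightarrow> 'a set set \<Rightarrow> bool" where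
  "three_uniform_hypergraph V E \<longleftrightarrow> (\<forall>e\<in>E. e \<subseteq> V \<and> card e = 3)"

(* Indices run over 0, ..., k - 1 instead of 1, ..., k. *)
definition is_linear_cycle :: "'a set set \<Rightarrow> bool" where
  "is_linear_cycle C \<longleftrightarrow>
     (\<exists>(k::nat) v w. k \<ge> 3 \<and>
        inj_on v {..<k} \<and> inj_on w {..<k} \<and> v ` {..<k} \<inter> w ` {..<k} = {} \<and>
        C = (\<lambda>i. {v i, w i, v (Suc i mod k)}) ` {..<k})"

definition has_linear_cycle :: "'a set set \<Rightarrow> bool" where
  "has_linear_cycle E \<longleftrightarrow> (\<exists>C\<subseteq>E. is_linear_cycle C)"

definition independent_set :: "'a set \<Rightarrow> 'a set set \<Rightarrow> 'a set \<Rightarrow> bool" where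
  "independent_set V E S \<longleftrightarrow> S \<subseteq> V \<and> (\<forall>e\<in>E. \<not> e \<subseteq> S)"

(* Meaningful for finite V: the maximum is then over a finite set, which is
   nonempty because the empty set is independent when every edge has three elements. *)
definition independence_number :: "'a set \<Rightarrow> 'a set set \<Rightarrow> nat" where
  "independence_number V E = Max {card S |S. independent_set V E S}"

end

(* Call D, P, Q a partial colouring of a vertex set S if P and Q partition S - D and no edge, inside
   S or leaving it, has two vertices in one of the classes P, Q without having a vertex in D or in the
   other class.  Starting from a single vertex, grow a set S in which any two vertices are joined by a
   linear path.  As long as some edge e meets S in one vertex g only, a block of three, four or five
   vertices around e can be glued to S at g.  An edge with one vertex in S - {g}, one in the block and
   one outside would close a linear cycle, so partial colourings of S and of the block that agree at g
   fit together.  To find the block, note that the sets of third vertices extending the three pairs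
   in e have no system of distinct representatives, as this would give a linear triangle; the few
   remaining configurations either have a partial colouring with D empty or consist of five
   vertices that no edge meets in exactly two vertices.  Blocks of the second kind need one uncoloured
   vertex, and a greedy choice pays for it with five vertices each, so |D| is at most |S|/5 and the
   larger colour class has at least 2|S|/5 elements.  If no edge meets a maximal S in exactly one
   vertex, this class can be added to an independent set of the rest. *)

theory Submission
  imports Defs
begin

section \<open>Linear paths\<close>

text \<open>A linear path is stored as the list \<open>[v\<^sub>0, w\<^sub>0, v\<^sub>1, w\<^sub>1, \<dots>, v\<^sub>m]\<close> of its vertices.\<close>

fun chain :: "'a set set \<Rightarrow> 'a list \<Rightarrow> bool" where
  "chain E [x] \<longleftrightarrow> True"
| "chain E (x # y # z # zs) \<longleftrightarrow> {x, y, z} \<in> E \<and> chain E (z # zs)"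
| "chain E _ \<longleftrightarrow> False"

lemma chain_append:
  "chain E (xs @ [g]) \<Longrightarrow> chain E (g # ys) \<Longrightarrow> chain E (xs @ g # ys)"
proof (induction "xs @ [g]" arbitrary: xs rule: chain.induct)
  case (1 E x)
  then show ?case by (cases xs) auto
next
  case (2 E x y z zs)
  from 2(2) obtain xs' where xs': "xs = x # y # xs'" "xs' @ [g] = z # zs"
    by (cases xs; cases "tl xs") auto
  have "chain E (xs' @ [g])"
    using 2(3) xs' by (metis "2.hyps"(2) chain.simps(2))
  then have "chain E (xs' @ g # ys)"
    using 2(1)[of xs'] 2(4) xs'(2) by simp
  moreover obtain r where "xs' @ g # ys = z # r"
    using xs'(2) by (cases xs') auto
  moreover have "{x, y, z} \<in> E"
    using 2(3) 2(2)[symmetric] by simp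
  ultimately show ?case using xs'(1) by simp
next
  case ("3_1" E)
  then show ?case by simp
next
  case ("3_2" E v va)
  then show ?case by (metis chain.simps(4))
qed

lemma odd_length_chain: "chain E xs \<Longrightarrow> odd (length xs)"
  by (induction E xs rule: chain.induct) auto

lemma chain_nth:
  "chain E xs \<Longrightarrow> 2 * i + 2 < length xs \<Longrightarrow> {xs ! (2*i), xs ! (2*i+1), xs ! (2*i+2)} \<in> E"
proof (induction E xs arbitrary: i rule: chain.induct)
  case (2 E x y z zs)
  then show ?case by (cases i) auto
qed auto

text \<open>In \<open>xs @ [t]\<close> the even positions hold the intersection vertices and the odd
  positions the private ones. Length at least 5 means at least two edges, so with the closing edge k
  is at least 3.\<close>

lemma closed_chain_has_linear_cycle:
  assumes "chain E xs" "distinct xs" "length xs \<ge> 5" "t \<notin> set xs"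
    and closing: "{last xs, t, hd xs} \<in> E"
  shows "has_linear_cycle E"
proof -
  define k where "k = (length xs + 1) div 2"
  have len: "length xs + 1 = 2 * k"
    using odd_length_chain[OF assms(1)] by (simp add: k_def)
  then have k3: "k \<ge> 3" using assms(3) by simp
  define ys where "ys = xs @ [t]"
  have dist: "distinct ys" and len_ys: "length ys = 2 * k"
    using assms len by (auto simp: ys_def)
  define v where "v = (\<lambda>i. ys ! (2 * i))"
  define w where "w = (\<lambda>i. ys ! (2 * i + 1))"
  have "inj_on v {..<k}" "inj_on w {..<k}"
    using dist len_ys by (auto simp: inj_on_def v_def w_def nth_eq_iff_index_eq)
  moreover have "v ` {..<k} \<inter> w ` {..<k} = {}"
  proof -
    have "v i \<noteq> w j" if "i < k" "j < k" for i j
    proof -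
      have "2 * i \<noteq> 2 * j + 1" by presburger
      then show ?thesis
        using that dist len_ys by (simp add: v_def w_def nth_eq_iff_index_eq)
    qed
    then show ?thesis by blast
  qed
  moreover have "{v i, w i, v (Suc i mod k)} \<in> E" if "i < k" for i
  proof (cases "Suc i < k")
    case True
    then have "2 * i + 2 < length xs" using len by simp
    then show ?thesis
      using chain_nth[OF assms(1), of i] True by (simp add: v_def w_def ys_def nth_append)
  next
    \<comment> \<open>The last index: \<open>w i\<close> is the appended \<open>t\<close>, and the
      next intersection vertex wraps around to the head.\<close>
    case False
    then have i: "Suc i = k" using that by simp
    have "xs \<noteq> []" using assms(3) by auto
    then have "v i = last xs" "w i = t" "v (Suc i mod k) = hd xs"
      using i len by (auto simp: v_def w_def ys_def nth_append last_conv_nth hd_conv_nth)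
    then show ?thesis using closing by simp
  qed
  ultimately have "is_linear_cycle ((\<lambda>i. {v i, w i, v (Suc i mod k)}) ` {..<k})"
    and "(\<lambda>i. {v i, w i, v (Suc i mod k)}) ` {..<k} \<subseteq> E"
    unfolding is_linear_cycle_def using k3 by blast+
  then show ?thesis unfolding has_linear_cycle_def by blast
qed

definition linked :: "'a set set \<Rightarrow> 'a set \<Rightarrow> 'a \<Rightarrow> 'a \<Rightarrow> bool" where
  "linked E S u v \<longleftrightarrow>
     (\<exists>xs. chain E xs \<and> distinct xs \<and> set xs \<subseteq> S \<and> hd xs = u \<and> last xs = v)"

definition linearly_connected :: "'a set set \<Rightarrow> 'a set \<Rightarrow> bool" where
  "linearly_connected E S \<longleftrightarrow> (\<forall>u\<in>S. \<forall>v\<in>S. linked E S u v)"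

lemma linked_refl: "u \<in> S \<Longrightarrow> linked E S u u"
  unfolding linked_def by (intro exI[of _ "[u]"]) simp

lemma linked_mono: "linked E S u v \<Longrightarrow> S \<subseteq> T \<Longrightarrow> linked E T u v"
  unfolding linked_def by blast

lemma chain_not_Nil: "chain E xs \<Longrightarrow> xs \<noteq> []"
  by auto

text \<open>The two paths share only \<open>g\<close>, so their concatenation repeats no vertex. The
  parities are recorded because a nonempty half then has at least two entries and so contributes an
  edge.\<close>

lemma linked_glue_path:
  assumes "linked E S u g" "linked E B g v" "S \<inter> B = {g}"
  obtains xs ys where "chain E (xs @ g # ys)" "distinct (xs @ g # ys)"
    "set (xs @ [g]) \<subseteq> S" "set (g # ys) \<subseteq> B" "hd (xs @ [g]) = u" "last (g # ys) = v"
    "even (length xs)" "even (length ys)"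
proof -
  obtain ps where ps: "chain E ps" "distinct ps" "set ps \<subseteq> S" "hd ps = u" "last ps = g"
    using assms(1) unfolding linked_def by blast
  obtain qs where qs: "chain E qs" "distinct qs" "set qs \<subseteq> B" "hd qs = g" "last qs = v"
    using assms(2) unfolding linked_def by blast
  obtain xs where xs: "ps = xs @ [g]"
    using ps(1,5) chain_not_Nil by (metis append_butlast_last_id)
  obtain ys where ys: "qs = g # ys"
    using qs(1,4) chain_not_Nil by (metis list.collapse)
  have "distinct (xs @ g # ys)"
    using ps qs assms(3) unfolding xs ys by auto
  moreover have "even (length xs)" "even (length ys)"
    using odd_length_chain[OF ps(1)] odd_length_chain[OF qs(1)] by (auto simp: xs ys)
  ultimately show thesis
    using that[of xs ys] ps qs chain_append[of E xs g ys] by (simp add: xs ys)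
qed

lemma linked_glue:
  assumes "linked E S u g" "linked E B g v" "S \<inter> B = {g}"
  shows "linked E (S \<union> B) u v"
proof -
  obtain xs ys where *: "chain E (xs @ g # ys)" "distinct (xs @ g # ys)"
    "set (xs @ [g]) \<subseteq> S" "set (g # ys) \<subseteq> B" "hd (xs @ [g]) = u" "last (g # ys) = v"
    using linked_glue_path[OF assms] by metis
  have "hd (xs @ g # ys) = u" "last (xs @ g # ys) = v" "set (xs @ g # ys) \<subseteq> S \<union> B"
    using * by (auto simp: hd_append split: if_splits)
  then show ?thesis unfolding linked_def using *(1,2) by blast
qed

lemma linearly_connected_glue:
  assumes "linearly_connected E S" "linearly_connected E B" "S \<inter> B = {g}"
  shows "linearly_connected E (S \<union> B)"
proof -
  have g: "g \<in> S" "g \<in> B" using assms(3) by auto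
  have "linked E (S \<union> B) u v" if "u \<in> S \<union> B" "v \<in> S \<union> B" for u v
  proof (cases "u \<in> S"; cases "v \<in> S")
    assume "u \<in> S" "v \<in> S"
    then show ?thesis
      using assms(1) linked_mono[of E S u v "S \<union> B"] by (auto simp: linearly_connected_def)
  next
    assume "u \<in> S" "v \<notin> S"
    then show ?thesis
      using assms that g linked_glue[of E S u g B v] by (auto simp: linearly_connected_def)
  next
    assume "u \<notin> S" "v \<in> S"
    then show ?thesis
      using assms that g linked_glue[of E B u g S v]
      by (auto simp: linearly_connected_def Un_commute Int_commute)
  next
    assume "u \<notin> S" "v \<notin> S"
    then show ?thesis
      using assms(2) that linked_mono[of E B u v "S \<union> B"] by (auto simp: linearly_connected_def)
  qed
  then show ?thesis by (simp add: linearly_connected_def)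
qed

section \<open>Linear-cycle-free triple systems\<close>

locale linear_cycle_free =
  fixes E :: "'a set set"
  assumes card_edge: "e \<in> E \<Longrightarrow> card e = 3"
    and no_linear_cycle: "\<not> has_linear_cycle E"
begin

lemma edge_distinct:
  assumes "{a, b, c} \<in> E"
  shows "a \<noteq> b" "a \<noteq> c" "b \<noteq> c"
  using card_edge[OF assms] by (auto simp: card_insert_if split: if_splits)

text \<open>The case k = 3, with corners \<open>a\<close>, \<open>b\<close>, \<open>c\<close> and
  private vertices \<open>x\<close>, \<open>y\<close>, \<open>z\<close>.\<close>

lemma no_triangle:
  assumes "{a, x, b} \<in> E" "{b, y, c} \<in> E" "{c, z, a} \<in> E"
    and "distinct [a, x, b, y, c, z]"
  shows False
  using closed_chain_has_linear_cycle[of E "[a, x, b, y, c]" z] assms no_linear_cycle by auto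

text \<open>A linear path from \<open>u\<close> through \<open>g\<close> to \<open>v\<close> has an
  edge on either side of \<open>g\<close>; an edge through \<open>u\<close> and \<open>v\<close>
  with its third vertex outside both sets would close it to a linear cycle.\<close>

lemma no_edge_across:
  assumes "linearly_connected E S" "linearly_connected E B" "S \<inter> B = {g}"
    and "u \<in> S" "v \<in> B" "u \<noteq> g" "v \<noteq> g" "{u, v, t} \<in> E"
  shows "t \<in> S \<union> B"
proof (rule ccontr)
  assume t: "t \<notin> S \<union> B"
  have "g \<in> S" "g \<in> B" using assms(3) by auto
  then have "linked E S u g" "linked E B g v"
    using assms(1,2,4,5) by (auto simp: linearly_connected_def)
  then obtain xs ys where *: "chain E (xs @ g # ys)" "distinct (xs @ g # ys)"
    "set (xs @ [g]) \<subseteq> S" "set (g # ys) \<subseteq> B" "hd (xs @ [g]) = u" "last (g # ys) = v"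
    "even (length xs)" "even (length ys)"
    using linked_glue_path[OF _ _ assms(3)] by metis
  have ne: "xs \<noteq> []" "ys \<noteq> []" using * assms(6,7) by auto
  moreover have "m \<ge> 2" if "even m" "m \<noteq> 0" for m :: nat
    using that by presburger
  ultimately have "length xs \<ge> 2" "length ys \<ge> 2"
    using *(7,8) by simp_all
  moreover have "hd (xs @ g # ys) = u" "last (xs @ g # ys) = v" "t \<notin> set (xs @ g # ys)"
    using * ne t by auto
  ultimately have "has_linear_cycle E"
    using closed_chain_has_linear_cycle[OF *(1,2), of t] assms(8) by (simp add: insert_commute)
  then show False using no_linear_cycle by contradiction
qed

lemma linked_edge:
  assumes "{a, b, c} \<in> E" "{a, b, c} \<subseteq> B" "u \<in> {a, b, c}" "v \<in> {a, b, c}"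
  shows "linked E B u v"
proof (cases "u = v")
  case True
  then show ?thesis using linked_refl assms(2,3) by (metis subsetD)
next
  case False
  then obtain w where w: "{a, b, c} = {u, w, v}"
    using assms(3,4) by auto
  then have "chain E [u, w, v]" "distinct [u, w, v]"
    using assms(1) edge_distinct[of u w v] by auto
  then show ?thesis
    unfolding linked_def using assms(2) w by (intro exI[of _ "[u, w, v]"]) auto
qed

lemma linked_two_edges:
  assumes "{a, b, c} \<in> E" "{c, d, e} \<in> E" "distinct [a, b, c, d, e]" "{a, b, c, d, e} \<subseteq> B"
  shows "linked E B a e" "linked E B e a"
  unfolding linked_def using assms
  by (intro exI[of _ "[a, b, c, d, e]"] exI[of _ "[e, d, c, b, a]"]; auto simp: insert_commute)+

lemma linearly_connected_edge: "{a, b, c} \<in> E \<Longrightarrow> linearly_connected E {a, b, c}"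
  unfolding linearly_connected_def using linked_edge[of a b c "{a, b, c}"] by blast

section \<open>Blocks\<close>

text \<open>The exemption for edges through \<open>g\<close> with \<open>t\<close> in
  \<open>S\<close> is harmless: if \<open>t\<close> had the colour of \<open>g\<close>, a colouring
  of \<open>S\<close> would force the remaining vertex into \<open>S\<close>, yet that vertex
  belongs to the block and differs from \<open>g\<close>.\<close>

definition split_block :: "'a set \<Rightarrow> 'a \<Rightarrow> 'a set \<Rightarrow> bool" where
  "split_block S g B \<longleftrightarrow> (\<exists>P Q. P \<union> Q = B \<and> P \<inter> Q = {} \<and> g \<in> P \<and>
     (\<forall>a\<in>P. \<forall>b\<in>P. \<forall>t. {a, b, t} \<in> E \<longrightarrow> t \<in> Q \<or> g \<in> {a, b} \<and> t \<in> S) \<and>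
     (\<forall>a\<in>Q. \<forall>b\<in>Q. \<forall>t. {a, b, t} \<in> E \<longrightarrow> t \<in> P))"

text \<open>The prototype is the complete 3-uniform hypergraph on five vertices, which has no split
  into two edge-free classes because one of them would have three vertices.\<close>

definition closed_block :: "'a set \<Rightarrow> bool" where
  "closed_block B \<longleftrightarrow> card B = 5 \<and> (\<forall>a\<in>B. \<forall>b\<in>B. \<forall>t. {a, b, t} \<in> E \<longrightarrow> t \<in> B)"

text \<open>\<open>B \<noteq> {g}\<close> makes gluing a proper enlargement, and
  \<open>B \<subseteq> \<Union>E\<close> keeps the block inside the vertex set, which the locale
  does not mention.\<close>

definition attachable :: "'a set \<Rightarrow> 'a \<Rightarrow> 'a set \<Rightarrow> bool" where
  "attachable S g B \<longleftrightarrow> S \<inter> B = {g} \<and> B \<noteq> {g} \<and> B \<subseteq> \<Union>E \<and> linearly_connected E B \<and>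
     (split_block S g B \<or> closed_block B)"

text \<open>The conditions are symmetric in \<open>P\<close> and \<open>Q\<close>, so it need not be
  known on which side \<open>g\<close> lies.\<close>

lemma split_blockI:
  assumes "P \<union> Q = B" "P \<inter> Q = {}" "g \<in> B"
    and P: "\<And>a b t. a \<in> P \<Longrightarrow> b \<in> P \<Longrightarrow> {a, b, t} \<in> E \<Longrightarrow> t \<in> Q"
    and Q: "\<And>a b t. a \<in> Q \<Longrightarrow> b \<in> Q \<Longrightarrow> {a, b, t} \<in> E \<Longrightarrow> t \<in> P"
  shows "split_block S g B"
proof (cases "g \<in> P")
  case True
  then show ?thesis unfolding split_block_def
    using assms by (intro exI[of _ P] exI[of _ Q]) blast
next
  case False
  then show ?thesis unfolding split_block_def
    using assms by (intro exI[of _ Q] exI[of _ P]) blast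
qed

lemma edge_through_two:
  assumes "{a, b, t} \<in> E" "a \<in> {p, q}" "b \<in> {p, q}"
  shows "{p, q, t} \<in> E"
  using assms edge_distinct[of a b t] by (auto simp: insert_commute)

lemma edge_through_three:
  assumes "{a, b, t} \<in> E" "a \<in> {p, q, r}" "b \<in> {p, q, r}"
  shows "{p, q, t} \<in> E \<or> {p, r, t} \<in> E \<or> {q, r, t} \<in> E"
  using assms edge_distinct[of a b t] by (auto simp: insert_commute)

text \<open>A fifth vertex joins the block when neither \<open>{q, w}\<close> nor \<open>{p, w}\<close> can be monochromatic.\<close>

lemma attachable_if_two_equal_extensions:
  assumes S: "linearly_connected E S" and gS: "S \<inter> {v, p, q, w} = {g}" and "w \<noteq> g"
    and e: "{v, p, q} \<in> E" "{v, p, w} \<in> E" "{v, q, w} \<in> E" and pq: "p \<noteq> q"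
    and vp: "\<And>t. {v, p, t} \<in> E \<Longrightarrow> t = q \<or> t = w"
    and vq: "\<And>t. {v, q, t} \<in> E \<Longrightarrow> t = p \<or> t = w"
  shows "\<exists>B. attachable S g B"
proof -
  note dist = edge_distinct[OF e(1)] edge_distinct[OF e(2)] edge_distinct[OF e(3)]
  define B where "B = {v, p, q, w}"
  have linked4: "\<forall>x\<in>{v, p, q, w}. \<forall>y\<in>{v, p, q, w}. linked E C x y"
    if "{v, p, q, w} \<subseteq> C" for C
    using that linked_edge[OF e(1), of C] linked_edge[OF e(2), of C] linked_edge[OF e(3), of C]
    by auto
  have conn: "linearly_connected E B"
    using linked4[of B] by (simp add: linearly_connected_def B_def)
  have base: "S \<inter> B = {g}" "g \<in> B" "B \<noteq> {g}" "B \<subseteq> \<Union>E"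
    using gS dist Union_upper[OF e(1)] Union_upper[OF e(2)] unfolding B_def by auto
  \<comment> \<open>Colour \<open>v\<close>, \<open>p\<close> against \<open>q\<close>,
    \<open>w\<close>. As \<open>vp\<close> controls the first class, only an edge through
    \<open>q\<close>, \<open>w\<close> that leaves the block can spoil this.\<close>
  have split1: "attachable S g B" if qw: "\<And>t. {q, w, t} \<in> E \<Longrightarrow> t = v \<or> t = p"
  proof -
    have "split_block S g B"
    proof (rule split_blockI[of "{v, p}" "{q, w}"])
      show "t \<in> {q, w}" if "a \<in> {v, p}" "b \<in> {v, p}" "{a, b, t} \<in> E" for a b t
        using vp[OF edge_through_two[OF that(3,1,2)]] by simp
      show "t \<in> {v, p}" if "a \<in> {q, w}" "b \<in> {q, w}" "{a, b, t} \<in> E" for a b t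
        using qw[OF edge_through_two[OF that(3,1,2)]] by simp
    qed (use base dist in \<open>auto simp: B_def\<close>)
    then show ?thesis unfolding attachable_def using base conn by blast
  qed
  have split2: "attachable S g B" if pw: "\<And>t. {p, w, t} \<in> E \<Longrightarrow> t = v \<or> t = q"
  proof -
    have "split_block S g B"
    proof (rule split_blockI[of "{v, q}" "{p, w}"])
      show "t \<in> {p, w}" if "a \<in> {v, q}" "b \<in> {v, q}" "{a, b, t} \<in> E" for a b t
        using vq[OF edge_through_two[OF that(3,1,2)]] by simp
      show "t \<in> {v, q}" if "a \<in> {p, w}" "b \<in> {p, w}" "{a, b, t} \<in> E" for a b t
        using pw[OF edge_through_two[OF that(3,1,2)]] by simp
    qed (use base dist pq in \<open>auto simp: B_def\<close>)
    then show ?thesis unfolding attachable_def using base conn by blast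
  qed
  show ?thesis
  proof (rule ccontr)
    assume none: "\<not> ?thesis"
    obtain s where s: "{q, w, s} \<in> E" "s \<noteq> v" "s \<noteq> p" using none split1 by blast
    obtain s' where s': "{p, w, s'} \<in> E" "s' \<noteq> v" "s' \<noteq> q" using none split2 by blast
    note dist' = edge_distinct[OF s(1)] edge_distinct[OF s'(1)]
    \<comment> \<open>Otherwise \<open>{p, t', w}\<close>, \<open>{w, t, q}\<close> and
      \<open>{q, v, p}\<close> form a linear triangle. Hence the obstructions to both splits come
      from one and the same fifth vertex.\<close>
    have same: "t = t'" if "{q, w, t} \<in> E" "t \<noteq> v" "t \<noteq> p" "{p, w, t'} \<in> E" "t' \<noteq> v" "t' \<noteq> q"
      for t t'
      using no_triangle[of p t' w t q v] that e dist pq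
        edge_distinct[OF that(1)] edge_distinct[OF that(4)]
      by (auto simp: insert_commute)
    have s'_eq: "s' = s" using same s s' by blast
    \<comment> \<open>If \<open>s\<close> were in \<open>S\<close>, the edge through
      \<open>s\<close>, \<open>w\<close> and whichever of \<open>p\<close>, \<open>q\<close> is not
      \<open>g\<close> would cross between \<open>S\<close> and \<open>{v, p, q}\<close> with
      \<open>w\<close> outside both.\<close>
    have "s \<notin> S"
    proof
      assume sS: "s \<in> S"
      have sg: "s \<noteq> g" using s dist' base unfolding B_def s'_eq by auto
      have wS: "w \<notin> S" using gS \<open>w \<noteq> g\<close> by auto
      have vpq: "S \<inter> {v, p, q} = {g}" using gS wS by auto
      consider "q \<noteq> g" | "p \<noteq> g" using pq by auto
      then show False
      proof cases
        case 1
        then show False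
          using no_edge_across[OF S linearly_connected_edge[OF e(1)] vpq sS _ sg, of q w]
            s wS dist pq by (auto simp: insert_commute)
      next
        case 2
        then show False
          using no_edge_across[OF S linearly_connected_edge[OF e(1)] vpq sS _ sg, of p w]
            s' s'_eq wS dist pq by (auto simp: insert_commute)
      qed
    qed
    define F where "F = {v, p, q, w, s}"
    note d = dist dist' pq s(2,3)
    have "linked E F x y" if "x \<in> F" "y \<in> F" for x y
    proof -
      \<comment> \<open>The only pair of \<open>F\<close> that lies in none of the five known
        edges.\<close>
      have "linked E F v s" "linked E F s v"
        using linked_two_edges[of v q p w s F] e s'(1) d s'_eq
        by (auto simp: F_def insert_commute)
      then show ?thesis
        using that linked4[of F] linked_edge[OF s(1), of F] linked_edge[OF s'(1), of F] s'_eq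
        unfolding F_def by auto
    qed
    then have "linearly_connected E F" by (simp add: linearly_connected_def)
    \<comment> \<open>Third vertices of \<open>v\<close>, \<open>s\<close> and of \<open>p\<close>,
      \<open>s\<close> other than \<open>q\<close> and \<open>w\<close> are excluded by linear
      triangles or by \<open>vp\<close>; \<open>same\<close> restricts those of \<open>q\<close>,
      \<open>w\<close> to \<open>v\<close>, \<open>p\<close> and \<open>s\<close>.\<close>
    moreover have "split_block S g F"
    proof (rule split_blockI[of "{v, s, p}" "{q, w}"])
      have vs: "t \<in> {q, w}" if t: "{v, s, t} \<in> E" for t
        using no_triangle[of v t s w p q] vp[of s] e s' s'_eq d t edge_distinct[OF t]
        by (cases "t = p") (auto simp: insert_commute)
      have ps: "t \<in> {q, w}" if t: "{p, s, t} \<in> E" for t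
        using no_triangle[of p t s w q v] vp[of s] e s s'_eq d t edge_distinct[OF t]
        by (cases "t = v") (auto simp: insert_commute)
      show "t \<in> {q, w}" if "a \<in> {v, s, p}" "b \<in> {v, s, p}" "{a, b, t} \<in> E" for a b t
        using edge_through_three[OF that(3,1,2)] vp[of t] vs[of t] ps[of t]
        by (auto simp: insert_commute)
      have qw: "t \<in> {v, s, p}" if "{q, w, t} \<in> E" for t
        using same[of t s] that s s' s'_eq by auto
      show "t \<in> {v, s, p}" if "a \<in> {q, w}" "b \<in> {q, w}" "{a, b, t} \<in> E" for a b t
        using qw[OF edge_through_two[OF that(3,1,2)]] .
    qed (use base d in \<open>auto simp: B_def F_def\<close>)
    moreover have "S \<inter> F = {g}" "F \<noteq> {g}" "F \<subseteq> \<Union>E"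
      using base \<open>s \<notin> S\<close> Union_upper[OF s(1)] unfolding F_def B_def by auto
    ultimately have "attachable S g F" unfolding attachable_def by blast
    then show False using none by blast
  qed
qed

text \<open>The classes are \<open>{a, b, w}\<close> and \<open>{c, u}\<close>. The pair
  \<open>a\<close>, \<open>b\<close> is controlled by assumption; for the pairs \<open>a\<close>,
  \<open>w\<close> and \<open>b\<close>, \<open>w\<close> and \<open>c\<close>, \<open>u\<close>, a
  wrongly placed third vertex contradicts that assumption or closes a linear triangle with two given
  edges.\<close>

lemma attachable_if_single_extension:
  assumes gS: "S \<inter> {a, b, c, u, w} = {g}"
    and e: "{a, b, c} \<in> E" "{a, b, u} \<in> E" "{a, c, w} \<in> E" "{b, c, w} \<in> E"
    and "u \<noteq> c" "u \<noteq> w"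
    and ab: "\<And>t. {a, b, t} \<in> E \<Longrightarrow> t = c \<or> t = u"
  shows "\<exists>B. attachable S g B"
proof -
  define B where "B = {a, b, c, u, w}"
  note d = edge_distinct[OF e(1)] edge_distinct[OF e(2)] edge_distinct[OF e(3)]
    edge_distinct[OF e(4)] assms(6,7)
  have "linked E B x y" if "x \<in> B" "y \<in> B" for x y
  proof -
    have "linked E B c u" "linked E B u c" "linked E B w u" "linked E B u w"
      using linked_two_edges[of c w a b u B] linked_two_edges[of w c a b u B] e d
      by (auto simp: B_def insert_commute)
    then show ?thesis
      using that linked_edge[OF e(1), of B] linked_edge[OF e(2), of B] linked_edge[OF e(3), of B]
        linked_edge[OF e(4), of B] unfolding B_def by auto
  qed
  then have "linearly_connected E B" by (simp add: linearly_connected_def)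
  moreover have "split_block S g B"
  proof (rule split_blockI[of "{a, b, w}" "{c, u}"])
    have aw: "t \<in> {c, u}" if t: "{a, w, t} \<in> E" for t
      using no_triangle[of a t w c b u] ab[of w] e d t edge_distinct[OF t]
      by (auto simp: insert_commute)
    have bw: "t \<in> {c, u}" if t: "{b, w, t} \<in> E" for t
      using no_triangle[of b t w c a u] ab[of w] e d t edge_distinct[OF t]
      by (cases "t = a") (auto simp: insert_commute)
    show "t \<in> {c, u}" if "x \<in> {a, b, w}" "y \<in> {a, b, w}" "{x, y, t} \<in> E" for x y t
      using edge_through_three[OF that(3,1,2)] ab[of t] aw[of t] bw[of t] by auto
    have cu: "t \<in> {a, b, w}" if t: "{c, u, t} \<in> E" for t
      using no_triangle[of c t u b a w] e d t edge_distinct[OF t]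
      by (auto simp: insert_commute)
    show "t \<in> {a, b, w}" if "x \<in> {c, u}" "y \<in> {c, u}" "{x, y, t} \<in> E" for x y t
      using cu[OF edge_through_two[OF that(3,1,2)]] .
  qed (use gS d in \<open>auto simp: B_def\<close>)
  moreover have "S \<inter> B = {g}" "B \<noteq> {g}" "B \<subseteq> \<Union>E"
    using gS d Union_upper[OF e(1)] Union_upper[OF e(2)] Union_upper[OF e(3)]
    unfolding B_def by auto
  ultimately have "attachable S g B" unfolding attachable_def by blast
  then show ?thesis by blast
qed

text \<open>Three of the ten pairs are closed by assumption. Each other pair is joined by a linear
  path of two given edges through all five vertices, which a third vertex outside would close to a
  linear triangle.\<close>

lemma attachable_if_all_extensions:
  assumes gS: "S \<inter> {a, b, c, u, w} = {g}"
    and e: "{a, b, c} \<in> E" "{a, b, u} \<in> E" "{a, b, w} \<in> E" "{a, c, u} \<in> E" "{a, c, w} \<in> E"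
      "{b, c, u} \<in> E" "{b, c, w} \<in> E" and "u \<noteq> w"
    and closed: "\<And>t. {a, b, t} \<in> E \<Longrightarrow> t \<in> {c, u, w}" "\<And>t. {a, c, t} \<in> E \<Longrightarrow> t \<in> {b, u, w}"
      "\<And>t. {b, c, t} \<in> E \<Longrightarrow> t \<in> {a, u, w}"
  shows "attachable S g {a, b, c, u, w}"
proof -
  define B where "B = {a, b, c, u, w}"
  note d = edge_distinct[OF e(1)] edge_distinct[OF e(2)] edge_distinct[OF e(3)]
    edge_distinct[OF e(4)] edge_distinct[OF e(5)] \<open>u \<noteq> w\<close>
  have "linked E B x y" if "x \<in> B" "y \<in> B" for x y
  proof -
    have "linked E B w u" "linked E B u w"
      using linked_two_edges[of w c a b u B] e d by (auto simp: B_def insert_commute)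
    then show ?thesis
      using that linked_edge[OF e(1), of B] linked_edge[OF e(2), of B] linked_edge[OF e(3), of B]
        linked_edge[OF e(4), of B] linked_edge[OF e(7), of B] linked_edge[OF e(6), of B]
      unfolding B_def by auto
  qed
  then have "linearly_connected E B" by (simp add: linearly_connected_def)
  moreover have "closed_block B"
  proof -
    define R where "R x y \<longleftrightarrow> (\<forall>t. {x, y, t} \<in> E \<longrightarrow> t \<in> B)" for x y
    have R_sym: "R y x" if "R x y" for x y
      using that by (simp add: R_def insert_commute)
    have R_base: "R a b" "R a c" "R b c"
      using closed by (auto simp: R_def B_def)
    have R_au: "R a u" unfolding R_def
    proof (intro allI impI)
      show "t \<in> B" if "{a, u, t} \<in> E" for t
        using no_triangle[of a t u c b w] e d that edge_distinct[OF that]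
        by (auto simp: insert_commute B_def)
    qed
    have R_aw: "R a w" unfolding R_def
    proof (intro allI impI)
      show "t \<in> B" if "{a, w, t} \<in> E" for t
        using no_triangle[of a t w c b u] e d that edge_distinct[OF that]
        by (auto simp: insert_commute B_def)
    qed
    have R_bu: "R b u" unfolding R_def
    proof (intro allI impI)
      show "t \<in> B" if "{b, u, t} \<in> E" for t
        using no_triangle[of b t u c a w] e d that edge_distinct[OF that]
        by (auto simp: insert_commute B_def)
    qed
    have R_bw: "R b w" unfolding R_def
    proof (intro allI impI)
      show "t \<in> B" if "{b, w, t} \<in> E" for t
        using no_triangle[of b t w c a u] e d that edge_distinct[OF that]
        by (auto simp: insert_commute B_def)
    qed
    have R_cu: "R c u" unfolding R_def
    proof (intro allI impI)
      show "t \<in> B" if "{c, u, t} \<in> E" for t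
        using no_triangle[of c t u b a w] e d that edge_distinct[OF that]
        by (auto simp: insert_commute B_def)
    qed
    have R_cw: "R c w" unfolding R_def
    proof (intro allI impI)
      show "t \<in> B" if "{c, w, t} \<in> E" for t
        using no_triangle[of c t w b a u] e d that edge_distinct[OF that]
        by (auto simp: insert_commute B_def)
    qed
    have R_uw: "R u w" unfolding R_def
    proof (intro allI impI)
      show "t \<in> B" if "{u, w, t} \<in> E" for t
        using no_triangle[of u t w a b c] e d that edge_distinct[OF that]
        by (auto simp: insert_commute B_def)
    qed
    note R = R_base R_au R_aw R_bu R_bw R_cu R_cw R_uw
    have "R x y" if "x \<in> B" "y \<in> B" "x \<noteq> y" for x y
      using that R R[THEN R_sym] unfolding B_def by (elim insertE emptyE) simp_all
    then have "t \<in> B" if "x \<in> B" "y \<in> B" "{x, y, t} \<in> E" for x y t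
      using that edge_distinct[OF that(3)] unfolding R_def by blast
    moreover have "card B = 5" using d by (simp add: B_def)
    ultimately show ?thesis unfolding closed_block_def by blast
  qed
  moreover have "S \<inter> B = {g}" "B \<noteq> {g}" "B \<subseteq> \<Union>E"
    using gS d Union_upper[OF e(1)] Union_upper[OF e(2)] Union_upper[OF e(3)]
    unfolding B_def by auto
  ultimately show ?thesis unfolding attachable_def B_def by blast
qed

text \<open>The classes are \<open>{g, w}\<close> and \<open>{x, y}\<close>. An edge through
  \<open>g\<close>, \<open>w\<close> whose third vertex is neither in \<open>S\<close> nor in
  \<open>{x, y}\<close> forms a linear triangle with \<open>{g, u, x}\<close> and
  \<open>{x, y, w}\<close>; a third vertex in \<open>S\<close> is exempt in
  \<open>split_block\<close>.\<close>

lemma attachable_if_extension_inside: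
  assumes S: "linearly_connected E S" and gS: "S \<inter> {g, x, y, w} = {g}"
    and e: "{g, x, y} \<in> E" "{g, x, w} \<in> E" "{x, y, w} \<in> E" "{g, x, u} \<in> E" and u: "u \<in> S"
    and xy: "\<And>t. {x, y, t} \<in> E \<Longrightarrow> t = g \<or> t = w"
  shows "\<exists>B. attachable S g B"
proof -
  define B where "B = {g, x, y, w}"
  note d = edge_distinct[OF e(1)] edge_distinct[OF e(2)] edge_distinct[OF e(3)]
    edge_distinct[OF e(4)]
  have "x \<notin> S" "y \<notin> S" "w \<notin> S"
    using gS d by auto
  have "linked E B a b" if "a \<in> B" "b \<in> B" for a b
    using that linked_edge[OF e(1), of B a b] linked_edge[OF e(2), of B a b]
      linked_edge[OF e(3), of B a b] unfolding B_def by auto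
  then have "linearly_connected E B" by (simp add: linearly_connected_def)
  moreover have "split_block S g B"
  proof -
    have gw: "t \<in> {x, y} \<or> t \<in> S" if t: "{g, w, t} \<in> E" for t
    proof (rule ccontr)
      assume *: "\<not> ?thesis"
      have "u \<noteq> y" "u \<noteq> w" "u \<noteq> t" using u \<open>y \<notin> S\<close> \<open>w \<notin> S\<close> * by auto
      then show False
        using no_triangle[of g u x y w t] e d t edge_distinct[OF t] *
        by (auto simp: insert_commute)
    qed
    show ?thesis unfolding split_block_def
    proof (rule exI[of _ "{g, w}"], rule exI[of _ "{x, y}"], intro conjI ballI allI impI)
      show "t \<in> {x, y} \<or> g \<in> {a, b} \<and> t \<in> S" if "a \<in> {g, w}" "b \<in> {g, w}" "{a, b, t} \<in> E" for a b t
        using gw[OF edge_through_two[OF that(3,1,2)]] that edge_distinct[OF that(3)] by auto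
      show "t \<in> {g, w}" if "a \<in> {x, y}" "b \<in> {x, y}" "{a, b, t} \<in> E" for a b t
        using xy[OF edge_through_two[OF that(3,1,2)]] by simp
    qed (use d in \<open>auto simp: B_def\<close>)
  qed
  moreover have "S \<inter> B = {g}" "B \<noteq> {g}" "B \<subseteq> \<Union>E"
    using gS d Union_upper[OF e(1)] Union_upper[OF e(2)] Union_upper[OF e(3)]
    unfolding B_def by auto
  ultimately have "attachable S g B" unfolding attachable_def by blast
  then show ?thesis by blast
qed

section \<open>Blocks consisting of a single edge\<close>

lemma attachable_edge:
  assumes "S \<inter> {g, x, y} = {g}" "{g, x, y} \<in> E" "split_block S g {g, x, y}"
  shows "attachable S g {g, x, y}"
  unfolding attachable_def
  using assms linearly_connected_edge[OF assms(2)] Union_upper[OF assms(2)] edge_distinct[OF assms(2)]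
  by auto

text \<open>Colour \<open>g\<close>, \<open>x\<close> against \<open>y\<close>; the exemption in
  \<open>split_block\<close> absorbs the extensions in \<open>S\<close>.\<close>

lemma attachable_if_extensions_inside:
  assumes gS: "S \<inter> {g, x, y} = {g}" and e: "{g, x, y} \<in> E"
    and gx: "\<And>t. {g, x, t} \<in> E \<Longrightarrow> t = y \<or> t \<in> S"
  shows "attachable S g {g, x, y}"
proof (rule attachable_edge[OF gS e])
  note d = edge_distinct[OF e]
  show "split_block S g {g, x, y}"
    unfolding split_block_def
  proof (rule exI[of _ "{g, x}"], rule exI[of _ "{y}"], intro conjI ballI allI impI)
    show "t \<in> {y} \<or> g \<in> {a, b} \<and> t \<in> S" if "a \<in> {g, x}" "b \<in> {g, x}" "{a, b, t} \<in> E" for a b t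
      using gx[OF edge_through_two[OF that(3,1,2)]] that edge_distinct[OF that(3)] by auto
    show "t \<in> {g, x}" if "a \<in> {y}" "b \<in> {y}" "{a, b, t} \<in> E" for a b t
      using that edge_distinct[OF that(3)] by auto
  qed (use d in auto)
qed

text \<open>Colour \<open>g\<close> against \<open>x\<close>, \<open>y\<close>; a class with one
  vertex meets no edge twice.\<close>

lemma attachable_if_no_outer_extension:
  assumes gS: "S \<inter> {g, x, y} = {g}" and e: "{g, x, y} \<in> E"
    and xy: "\<And>t. {x, y, t} \<in> E \<Longrightarrow> t = g"
  shows "attachable S g {g, x, y}"
proof (rule attachable_edge[OF gS e])
  note d = edge_distinct[OF e]
  show "split_block S g {g, x, y}"
  proof (rule split_blockI[of "{g}" "{x, y}"])
    show "t \<in> {x, y}" if "a \<in> {g}" "b \<in> {g}" "{a, b, t} \<in> E" for a b t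
      using that edge_distinct[OF that(3)] by auto
    show "t \<in> {g}" if "a \<in> {x, y}" "b \<in> {x, y}" "{a, b, t} \<in> E" for a b t
      using xy[OF edge_through_two[OF that(3,1,2)]] by simp
  qed (use d in auto)
qed

section \<open>Extensions of the pairs in an edge\<close>

definition extensions :: "'a \<Rightarrow> 'a \<Rightarrow> 'a \<Rightarrow> 'a set" where
  "extensions a b c = {t. {a, b, t} \<in> E \<and> t \<noteq> c}"

lemma extensions_commute: "extensions a b c = extensions b a c"
  by (simp add: extensions_def insert_commute)

text \<open>Distinct representatives would be the private vertices of a linear triangle with corners
  \<open>g\<close>, \<open>x\<close>, \<open>y\<close>; leaving out the third vertex in
  \<open>extensions\<close> keeps them off the corners.\<close>

lemma extensions_no_distinct_representatives:
  assumes e: "{g, x, y} \<in> E"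
    and "a \<in> extensions g x y" "b \<in> extensions g y x" "c \<in> extensions x y g"
  shows "a = b \<or> b = c \<or> a = c"
proof (rule ccontr)
  assume "\<not> ?thesis"
  moreover have t: "{g, a, x} \<in> E" "{x, c, y} \<in> E" "{y, b, g} \<in> E" "a \<noteq> y" "b \<noteq> x" "c \<noteq> g"
    using assms by (auto simp: extensions_def insert_commute)
  ultimately show False
    using no_triangle[OF t(1-3)] edge_distinct[OF e] edge_distinct[OF t(1)]
      edge_distinct[OF t(2)] edge_distinct[OF t(3)] by auto
qed

text \<open>Allows the later case analysis to assume that no extension of \<open>g\<close>,
  \<open>x\<close> lies in \<open>S\<close>. Since \<open>u\<close> differs from every vertex
  outside \<open>S\<close>, the lack of distinct representatives leaves \<open>\<beta>\<close> as
  the only extension of \<open>x\<close>, \<open>y\<close>, and \<open>\<beta>\<close> also extends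
  \<open>g\<close>, \<open>x\<close>; then \<open>attachable_if_extension_inside\<close>
  applies.\<close>

lemma attachable_if_inner_extension:
  assumes S: "linearly_connected E S" and gS: "S \<inter> {g, x, y} = {g}" and e: "{g, x, y} \<in> E"
    and "u \<in> extensions g x y" "u \<in> S"
    and "\<alpha> \<in> extensions g x y" "\<alpha> \<notin> S" and "\<beta> \<in> extensions g y x" "\<beta> \<notin> S"
    and C: "extensions x y g \<noteq> {}"
    and not_equal: "\<And>w. \<not> (extensions g y x = {w} \<and> extensions x y g = {w})"
  shows "\<exists>B. attachable S g B"
proof -
  note d = edge_distinct[OF e]
  have xy: "x \<notin> S" "y \<notin> S" "g \<in> S" using gS d by auto
  have \<alpha>: "{g, x, \<alpha>} \<in> E" "\<alpha> \<noteq> y" using assms(6) by (auto simp: extensions_def)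
  \<comment> \<open>Such an edge would cross from \<open>S\<close> to
    \<open>{g, x, \<alpha>}\<close> with \<open>y\<close> outside both.\<close>
  have C_outside: "c \<notin> S" if "c \<in> extensions x y g" for c
  proof
    assume "c \<in> S"
    have c: "{c, x, y} \<in> E" "c \<noteq> g" using that by (auto simp: extensions_def insert_commute)
    have "S \<inter> {g, x, \<alpha>} = {g}" using xy \<open>\<alpha> \<notin> S\<close> by auto
    then have "y \<in> S \<union> {g, x, \<alpha>}"
      using no_edge_across[OF S linearly_connected_edge[OF \<alpha>(1)] _ \<open>c \<in> S\<close>, of g x y] c d by auto
    then show False using xy \<alpha>(2) d by auto
  qed
  have eq: "b = c" if "b \<in> extensions g y x" "b \<notin> S" "c \<in> extensions x y g" for b c
    using extensions_no_distinct_representatives[OF e assms(4) that(1,3)] C_outside[OF that(3)] that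
      \<open>u \<in> S\<close> by auto
  have C_eq: "extensions x y g = {\<beta>}"
    using C eq assms(8,9) by blast
  have "\<beta> \<in> extensions g x y"
  proof (cases "\<alpha> = \<beta>")
    \<comment> \<open>An extension \<open>b\<close> of \<open>g\<close>, \<open>y\<close> other than
      \<open>\<beta>\<close> lies in \<open>S\<close>, so \<open>\<alpha>\<close>, \<open>b\<close>,
      \<open>\<beta>\<close> would be distinct representatives: this case cannot occur.\<close>
    case False
    obtain b where b: "b \<in> extensions g y x" "b \<noteq> \<beta>"
      using not_equal[of \<beta>] C_eq assms(8) by blast
    then have "b \<in> S" using eq[of b \<beta>] C_eq by auto
    then show ?thesis
      using extensions_no_distinct_representatives[OF e assms(6) b(1), of \<beta>] C_eq b False \<open>\<alpha> \<notin> S\<close>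
      by auto
  qed (use assms(6) in simp)
  then have e': "{g, x, \<beta>} \<in> E" "{x, y, \<beta>} \<in> E" "{g, x, u} \<in> E"
    using C_eq assms(4) by (auto simp: extensions_def)
  have "S \<inter> {g, x, y, \<beta>} = {g}" using xy \<open>\<beta> \<notin> S\<close> by auto
  moreover have "t = g \<or> t = \<beta>" if "{x, y, t} \<in> E" for t
    using that C_eq by (auto simp: extensions_def)
  ultimately show ?thesis
    using attachable_if_extension_inside[OF S _ e e' \<open>u \<in> S\<close>] by blast
qed

end

section \<open>Three sets without a system of distinct representatives\<close>

text \<open>Distinct elements \<open>b\<close> of \<open>B\<close> and \<open>c\<close> of
  \<open>C\<close> leave only these two values for \<open>A\<close>, which therefore equals
  \<open>{b, c}\<close>; a further element of \<open>B\<close> or \<open>C\<close> would then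
  complete a system.\<close>

lemma no_distinct_representatives_aux:
  assumes sdr: "\<And>a b c. a \<in> A \<Longrightarrow> b \<in> B \<Longrightarrow> c \<in> C \<Longrightarrow> a = b \<or> b = c \<or> a = c"
    and "B \<noteq> {}" "C \<noteq> {}" and BC: "\<And>w. \<not> (B = {w} \<and> C = {w})"
    and A: "a \<in> A" "a' \<in> A" "a \<noteq> a'"
  shows "\<exists>u w. u \<noteq> w \<and> A = {u, w} \<and> u \<in> B \<and> w \<in> C \<and> B \<subseteq> {u, w} \<and> C \<subseteq> {u, w}"
proof -
  obtain b c where bc: "b \<in> B" "c \<in> C" "b \<noteq> c"
  proof -
    obtain b where b: "b \<in> B" using \<open>B \<noteq> {}\<close> by blast
    obtain c where c: "c \<in> C" using \<open>C \<noteq> {}\<close> by blast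
    have "(\<exists>x\<in>B. x \<noteq> c) \<or> (\<exists>x\<in>C. x \<noteq> c)"
      using BC[of c] b c unfolding set_eq_iff by fast
    then show thesis using that b c by metis
  qed
  have "A \<subseteq> {b, c}" using sdr bc by blast
  then have "A = {b, c}" using A by blast
  moreover have "B \<subseteq> {b, c}"
  proof
    fix b' assume "b' \<in> B"
    then show "b' \<in> {b, c}" using sdr[of a b' c] sdr[of a' b' c] bc A \<open>A = {b, c}\<close> by auto
  qed
  moreover have "C \<subseteq> {b, c}"
  proof
    fix c' assume "c' \<in> C"
    then show "c' \<in> {b, c}" using sdr[of a b c'] sdr[of a' b c'] bc A \<open>A = {b, c}\<close> by auto
  qed
  ultimately show ?thesis using bc by blast
qed

text \<open>Nonemptiness and \<open>eq\<close> are Hall's conditions for one and two of the sets, so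
  the condition for all three fails and their union has two elements. A set smaller than the union
  is a singleton, and the other two must contain the other element.\<close>

lemma no_distinct_representatives_cases:
  assumes sdr: "\<And>a b c. a \<in> A \<Longrightarrow> b \<in> B \<Longrightarrow> c \<in> C \<Longrightarrow> a = b \<or> b = c \<or> a = c"
    and ne: "A \<noteq> {}" "B \<noteq> {}" "C \<noteq> {}"
    and eq: "\<And>w. \<not> (A = {w} \<and> B = {w})" "\<And>w. \<not> (A = {w} \<and> C = {w})"
      "\<And>w. \<not> (B = {w} \<and> C = {w})"
  obtains (full) u w where "u \<noteq> w" "A = {u, w}" "B = {u, w}" "C = {u, w}"
  | (first) u w where "u \<noteq> w" "A = {u}" "w \<in> B" "w \<in> C"
  | (second) u w where "u \<noteq> w" "B = {u}" "w \<in> A" "w \<in> C"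
  | (third) u w where "u \<noteq> w" "C = {u}" "w \<in> A" "w \<in> B"
proof -
  have key: "(X = {u, w} \<and> Y = {u, w} \<and> Z = {u, w}) \<or> (Y = {u} \<and> w \<in> X \<and> w \<in> Z)
      \<or> (Z = {w} \<and> u \<in> X \<and> u \<in> Y)"
    if "X = {u, w}" "u \<in> Y" "w \<in> Z" "Y \<subseteq> {u, w}" "Z \<subseteq> {u, w}" for X Y Z :: "'a set" and u w
    using that by blast
  consider (A) a a' where "a \<in> A" "a' \<in> A" "a \<noteq> a'"
    | (B) b b' where "b \<in> B" "b' \<in> B" "b \<noteq> b'"
    | (C) c c' where "c \<in> C" "c' \<in> C" "c \<noteq> c'"
  proof -
    obtain a b c where abc: "a \<in> A" "b \<in> B" "c \<in> C" using ne by blast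
    have "\<not> (A = {a} \<and> B = {b} \<and> C = {c})"
      using sdr[OF abc] eq(1)[of a] eq(2)[of a] eq(3)[of b] by auto
    then show thesis using that abc by blast
  qed
  then show thesis
  proof cases
    case A
    obtain u w where "u \<noteq> w" "A = {u, w}" "u \<in> B" "w \<in> C" "B \<subseteq> {u, w}" "C \<subseteq> {u, w}"
      using no_distinct_representatives_aux[OF sdr ne(2,3) eq(3) A] by blast
    then show thesis using key[of A u w B C] full second third by metis
  next
    case B
    have "b = a \<or> a = c \<or> b = c" if "b \<in> B" "a \<in> A" "c \<in> C" for a b c
      using sdr that by blast
    from no_distinct_representatives_aux[OF this ne(1,3) eq(2) B]
    obtain u w where "u \<noteq> w" "B = {u, w}" "u \<in> A" "w \<in> C" "A \<subseteq> {u, w}" "C \<subseteq> {u, w}" by blast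
    then show thesis using key[of B u w A C] full first third by metis
  next
    case C
    have "c = a \<or> a = b \<or> c = b" if "c \<in> C" "a \<in> A" "b \<in> B" for a b c
      using sdr that by blast
    from no_distinct_representatives_aux[OF this ne(1,2) eq(1) C]
    obtain u w where "u \<noteq> w" "C = {u, w}" "u \<in> A" "w \<in> B" "A \<subseteq> {u, w}" "B \<subseteq> {u, w}" by blast
    then show thesis using key[of C u w A B] full first second by metis
  qed
qed

section \<open>Existence of a block at an edge meeting the set once\<close>

context linear_cycle_free
begin

text \<open>Without an attachable block the three extension sets are nonempty, disjoint from
  \<open>S\<close>, and no two are the same singleton.
  \<open>no_distinct_representatives_cases\<close> then leaves four shapes, each covered by a block
  lemma.\<close>

lemma exists_attachable:
  assumes S: "linearly_connected E S" and gS: "S \<inter> {g, x, y} = {g}" and e: "{g, x, y} \<in> E"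
  shows "\<exists>B. attachable S g B"
proof (rule ccontr)
  assume none: "\<not> ?thesis"
  note d = edge_distinct[OF e]
  have xy: "x \<notin> S" "y \<notin> S" "g \<in> S" using gS d by auto
  have e': "{g, y, x} \<in> E" "{x, g, y} \<in> E" "{y, g, x} \<in> E" "{x, y, g} \<in> E"
    using e by (simp_all add: insert_commute)
  have gS': "S \<inter> {g, y, x} = {g}" using gS by (simp add: insert_commute)
  define A where "A = extensions g x y"
  define B where "B = extensions g y x"
  define C where "C = extensions x y g"
  have memA: "t \<in> A \<longleftrightarrow> {g, x, t} \<in> E \<and> t \<noteq> y" for t by (simp add: A_def extensions_def)
  have memB: "t \<in> B \<longleftrightarrow> {g, y, t} \<in> E \<and> t \<noteq> x" for t by (simp add: B_def extensions_def)
  have memC: "t \<in> C \<longleftrightarrow> {x, y, t} \<in> E \<and> t \<noteq> g" for t by (simp add: C_def extensions_def)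
  \<comment> \<open>If all extensions of \<open>g\<close>, \<open>x\<close> lay in \<open>S\<close>,
    the edge itself would be attachable; likewise for \<open>g\<close>, \<open>y\<close>.\<close>
  obtain \<alpha> where \<alpha>: "\<alpha> \<in> A" "\<alpha> \<notin> S"
    using attachable_if_extensions_inside[OF gS e] none memA by blast
  obtain \<beta> where \<beta>: "\<beta> \<in> B" "\<beta> \<notin> S"
    using attachable_if_extensions_inside[OF gS' e'(1)] none memB by blast
  have "C \<noteq> {}"
    using attachable_if_no_outer_extension[OF gS e] none memC by blast
  \<comment> \<open>The vertex common to the two pairs plays the role of \<open>v\<close>: here
    \<open>g\<close>, in the next two steps \<open>x\<close> and \<open>y\<close>.\<close>
  have AB: "\<not> (A = {w} \<and> B = {w})" for w
  proof
    assume *: "A = {w} \<and> B = {w}"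
    then have w: "w \<notin> S" "{g, x, w} \<in> E" "{g, y, w} \<in> E" using \<alpha> memA[of w] memB[of w] by auto
    have gSw: "S \<inter> {g, x, y, w} = {g}" "w \<noteq> g" using xy w(1) by auto
    have "t = y \<or> t = w" if "{g, x, t} \<in> E" for t
      using that * memA[of t] by auto
    moreover have "t = x \<or> t = w" if "{g, y, t} \<in> E" for t
      using that * memB[of t] by auto
    ultimately show False
      using attachable_if_two_equal_extensions[OF S gSw e w(2,3) d(3)] none by blast
  qed
  have AC: "\<not> (A = {w} \<and> C = {w})" for w
  proof
    assume *: "A = {w} \<and> C = {w}"
    then have w: "w \<notin> S" "{x, g, w} \<in> E" "{x, y, w} \<in> E"
      using \<alpha> memA[of w] memC[of w] by (auto simp: insert_commute)
    have gSw: "S \<inter> {x, g, y, w} = {g}" "w \<noteq> g" using xy w(1) by auto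
    have "t = y \<or> t = w" if "{x, g, t} \<in> E" for t
      using that * memA[of t] by (auto simp: insert_commute)
    moreover have "t = g \<or> t = w" if "{x, y, t} \<in> E" for t
      using that * memC[of t] by auto
    ultimately show False
      using attachable_if_two_equal_extensions[OF S gSw e'(2) w(2,3) d(2)] none by blast
  qed
  have BC: "\<not> (B = {w} \<and> C = {w})" for w
  proof
    assume *: "B = {w} \<and> C = {w}"
    then have w: "w \<notin> S" "{y, g, w} \<in> E" "{y, x, w} \<in> E"
      using \<beta> memB[of w] memC[of w] by (auto simp: insert_commute)
    have gSw: "S \<inter> {y, g, x, w} = {g}" "w \<noteq> g" using xy w(1) by auto
    have "t = x \<or> t = w" if "{y, g, t} \<in> E" for t
      using that * memB[of t] by (auto simp: insert_commute)
    moreover have "t = g \<or> t = w" if "{y, x, t} \<in> E" for t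
      using that * memC[of t] by (auto simp: insert_commute)
    ultimately show False
      using attachable_if_two_equal_extensions[OF S gSw e'(3) w(2,3) d(1)] none by blast
  qed
  have A_outside: "A \<inter> S = {}"
    using attachable_if_inner_extension[OF S gS e _ _ \<alpha>[unfolded A_def] \<beta>[unfolded B_def]
        \<open>C \<noteq> {}\<close>[unfolded C_def] BC[unfolded B_def C_def]] none
    by (auto simp: A_def)
  \<comment> \<open>The same argument with \<open>x\<close> and \<open>y\<close> exchanged.\<close>
  have B_outside: "B \<inter> S = {}"
    using attachable_if_inner_extension[OF S gS' e'(1) _ _ \<beta>[unfolded B_def] \<alpha>[unfolded A_def],
        unfolded extensions_commute[of y x], OF _ _ \<open>C \<noteq> {}\<close>[unfolded C_def]
        AC[unfolded A_def C_def]] none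
    by (auto simp: B_def)
  have C_outside: "c \<notin> S" if "c \<in> C" for c
  proof
    assume "c \<in> S"
    have c: "{c, x, y} \<in> E" "c \<noteq> g" using that memC[of c] by (auto simp: insert_commute)
    have \<alpha>': "{g, x, \<alpha>} \<in> E" "\<alpha> \<noteq> y" using \<alpha> memA[of \<alpha>] by auto
    have "S \<inter> {g, x, \<alpha>} = {g}" using xy \<open>\<alpha> \<notin> S\<close> by auto
    then have "y \<in> S \<union> {g, x, \<alpha>}"
      using no_edge_across[OF S linearly_connected_edge[OF \<alpha>'(1)] _ \<open>c \<in> S\<close>, of g x y] c d by auto
    then show False using xy \<alpha>'(2) d by auto
  qed
  have sdr: "a = b \<or> b = c \<or> a = c" if "a \<in> A" "b \<in> B" "c \<in> C" for a b c
    using extensions_no_distinct_representatives[OF e] that unfolding A_def B_def C_def by blast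
  have ne: "A \<noteq> {}" "B \<noteq> {}" using \<alpha> \<beta> by auto
  show False
  proof (rule no_distinct_representatives_cases[OF sdr ne \<open>C \<noteq> {}\<close> AB AC BC])
    fix u w assume *: "u \<noteq> w" "A = {u, w}" "B = {u, w}" "C = {u, w}"
    have "u \<notin> S" "w \<notin> S" using * A_outside by auto
    then have gSw: "S \<inter> {g, x, y, u, w} = {g}" using xy by auto
    have E: "{g, x, u} \<in> E" "{g, x, w} \<in> E" "{g, y, u} \<in> E" "{g, y, w} \<in> E"
      "{x, y, u} \<in> E" "{x, y, w} \<in> E"
      using * memA[of u] memA[of w] memB[of u] memB[of w] memC[of u] memC[of w] by auto
    have c1: "t \<in> {y, u, w}" if "{g, x, t} \<in> E" for t using that memA[of t] * by auto
    have c2: "t \<in> {x, u, w}" if "{g, y, t} \<in> E" for t using that memB[of t] * by auto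
    have c3: "t \<in> {g, u, w}" if "{x, y, t} \<in> E" for t using that memC[of t] * by auto
    show False
      using attachable_if_all_extensions[OF gSw e E(1,2,3,4,5,6) *(1) c1 c2 c3] none by blast
  next
    fix u w assume *: "u \<noteq> w" "A = {u}" "w \<in> B" "w \<in> C"
    have "u \<notin> S" "w \<notin> S" using * A_outside B_outside by auto
    then have gSw: "S \<inter> {g, x, y, u, w} = {g}" using xy by auto
    have E: "{g, x, u} \<in> E" "{g, y, w} \<in> E" "{x, y, w} \<in> E" "u \<noteq> y"
      using * memA[of u] memB[of w] memC[of w] by auto
    have c: "t = y \<or> t = u" if "{g, x, t} \<in> E" for t using that memA[of t] * by auto
    show False
      using attachable_if_single_extension[OF gSw e E *(1) c] none by blast
  next
    fix u w assume *: "u \<noteq> w" "B = {u}" "w \<in> A" "w \<in> C"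
    have "u \<notin> S" "w \<notin> S" using * A_outside B_outside by auto
    then have gSw: "S \<inter> {g, y, x, u, w} = {g}" using xy by auto
    have E: "{g, y, u} \<in> E" "{g, x, w} \<in> E" "{y, x, w} \<in> E" "u \<noteq> x"
      using * memA[of w] memB[of u] memC[of w] by (auto simp: insert_commute)
    have c: "t = x \<or> t = u" if "{g, y, t} \<in> E" for t using that memB[of t] * by auto
    show False
      using attachable_if_single_extension[OF gSw e'(1) E *(1) c] none by blast
  next
    fix u w assume *: "u \<noteq> w" "C = {u}" "w \<in> A" "w \<in> B"
    have "u \<notin> S" "w \<notin> S" using * A_outside C_outside by auto
    then have gSw: "S \<inter> {x, y, g, u, w} = {g}" using xy by auto
    have E: "{x, y, u} \<in> E" "{x, g, w} \<in> E" "{y, g, w} \<in> E" "u \<noteq> g"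
      using * memA[of w] memB[of w] memC[of u] by (auto simp: insert_commute)
    have c: "t = g \<or> t = u" if "{x, y, t} \<in> E" for t using that memC[of t] * by auto
    show False
      using attachable_if_single_extension[OF gSw e'(4) E *(1) c] none by blast
  qed
qed

section \<open>Partial two-colourings\<close>

text \<open>\<open>P\<close> and \<open>Q\<close> are the colour classes and \<open>D\<close> is the set of uncoloured vertices.
  Edges leaving \<open>S\<close> are constrained, too: such an edge cannot have two vertices of one colour.\<close>

definition colouring :: "'a set \<Rightarrow> 'a set \<Rightarrow> 'a set \<Rightarrow> 'a set \<Rightarrow> bool" where
  "colouring S D P Q \<longleftrightarrow> P \<union> Q = S - D \<and> P \<inter> Q = {} \<and>
     (\<forall>a\<in>P. \<forall>b\<in>P. \<forall>t. {a, b, t} \<in> E \<longrightarrow> t \<in> Q \<union> D) \<and>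
     (\<forall>a\<in>Q. \<forall>b\<in>Q. \<forall>t. {a, b, t} \<in> E \<longrightarrow> t \<in> P \<union> D)"

lemma colouring_commute: "colouring S D P Q \<Longrightarrow> colouring S D Q P"
  unfolding colouring_def by (simp add: Un_commute Int_commute)

text \<open>The pair \<open>a\<close>, \<open>b\<close> comes from \<open>S\<close>, from the block,
  or has one vertex in each. The last two cases are traced back to a pair of one colour inside
  \<open>S\<close>, whose third vertex must lie in \<open>S\<close>.\<close>

lemma colouring_glue_class:
  assumes S: "linearly_connected E S" and B: "linearly_connected E B" and SB: "S \<inter> B = {g}"
    and col: "colouring S D P Q" and "D \<subseteq> S" and D': "D' \<subseteq> B - {g}"
    and P'Q': "P' \<union> Q' = B - (D \<union> D')" and g: "g \<in> P \<longleftrightarrow> g \<in> P'" "g \<in> Q \<longleftrightarrow> g \<in> Q'"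
    and P': "\<And>a b t. a \<in> P' \<Longrightarrow> b \<in> P' \<Longrightarrow> {a, b, t} \<in> E \<Longrightarrow>
      t \<in> Q' \<union> D \<union> D' \<or> g \<in> {a, b} \<and> t \<in> S"
    and ab: "a \<in> P \<union> P'" "b \<in> P \<union> P'" "{a, b, t} \<in> E"
  shows "t \<in> (Q \<union> Q') \<union> (D \<union> D')"
proof (rule ccontr)
  assume t: "\<not> ?thesis"
  have PQ: "P \<union> Q = S - D" and P: "\<And>a b t. a \<in> P \<Longrightarrow> b \<in> P \<Longrightarrow> {a, b, t} \<in> E \<Longrightarrow> t \<in> Q \<union> D"
    using col by (auto simp: colouring_def)
  have PB: "x = g" if "x \<in> P" "x \<in> B" for x using that PQ SB by blast
  have P'S: "x = g" if "x \<in> P'" "x \<in> S" for x using that P'Q' SB by blast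
  have QD_S: "Q \<union> D \<subseteq> S" using PQ \<open>D \<subseteq> S\<close> by blast
  have P'B: "P' \<subseteq> B" "Q' \<subseteq> B" and PS: "P \<subseteq> S" using P'Q' PQ by blast+
  have inS: "x \<in> P" if "x \<in> S" "x \<notin> Q" "x \<notin> D" for x using that PQ by blast
  have inB: "x \<in> P'" if "x \<in> B" "x \<notin> Q'" "x \<notin> D \<union> D'" for x using that P'Q' by blast
  have both_P: False if "x \<in> P" "y \<in> P" "{x, y, t} \<in> E" for x y
    using P[OF that] t by blast
  have both_P': False if xy: "x \<in> P'" "y \<in> P'" "{x, y, t} \<in> E" for x y
  proof -
    \<comment> \<open>The exempt case: \<open>g\<close> and \<open>t\<close> form a pair of one
      colour in \<open>S\<close>, so the remaining vertex is in \<open>S\<close> too and can only be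
      \<open>g\<close>.\<close>
    have tS: "t \<in> S" "g = x \<or> g = y" using P'[OF xy] t by auto
    then have "t \<in> P" using inS t by blast
    obtain z where z: "z \<in> P'" "{g, t, z} \<in> E" "g \<in> P'"
      using tS(2) xy by (auto simp: insert_commute)
    have "z \<in> Q \<union> D" using P[OF _ \<open>t \<in> P\<close> z(2)] z(3) g(1) by blast
    then have "z = g" using P'S z(1) QD_S by blast
    then show False using edge_distinct[OF z(2)] by blast
  qed
  have mixed: False if x: "x \<in> P" and y: "y \<in> P'" and xyt: "{x, y, t} \<in> E" for x y
  proof -
    have "x \<noteq> g" using both_P' x y xyt g(1) by blast
    have "y \<noteq> g" using both_P x y xyt g(1) by blast
    \<comment> \<open>For a pair with one vertex on either side of \<open>g\<close>, it is the
      absence of linear cycles that keeps the third vertex inside.\<close>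
    have "t \<in> S \<union> B"
      using no_edge_across[OF S B SB _ _ \<open>x \<noteq> g\<close> \<open>y \<noteq> g\<close> xyt] x y PS P'B by blast
    then show False
    proof
      assume "t \<in> S"
      then have "t \<in> P" using inS t by blast
      have "{x, t, y} \<in> E" using xyt by (simp add: insert_commute)
      then have "y \<in> Q \<union> D" using P[OF x \<open>t \<in> P\<close>] by blast
      then show False using P'S[OF y] QD_S \<open>y \<noteq> g\<close> by blast
    next
      assume "t \<in> B"
      then have tP': "t \<in> P'" using inB t by blast
      have e: "{y, t, x} \<in> E" "{x, t, y} \<in> E" using xyt by (simp_all add: insert_commute)
      have "x \<notin> B" using PB[OF x] \<open>x \<noteq> g\<close> by blast
      moreover have "x \<notin> D" using x PQ by blast
      ultimately have "g \<in> {y, t}" using P'[OF y tP' e(1)] P'B D' by blast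
      then have "t \<in> P" using \<open>y \<noteq> g\<close> tP' g(1) by blast
      then have "y \<in> Q \<union> D" using P[OF x _ e(2)] by blast
      then show False using P'S[OF y] QD_S \<open>y \<noteq> g\<close> by blast
    qed
  qed
  have "{b, a, t} \<in> E" using ab(3) by (simp add: insert_commute)
  then show False using ab both_P both_P' mixed by blast
qed

text \<open>As \<open>g\<close> avoids both \<open>Q\<close> and \<open>Q'\<close>, it is in the
  first class of both colourings or uncoloured in both, so they agree at \<open>g\<close>.\<close>

lemma colouring_glue:
  assumes S: "linearly_connected E S" and B: "linearly_connected E B" and SB: "S \<inter> B = {g}"
    and col: "colouring S D P Q" and D: "D \<subseteq> S" and D': "D' \<subseteq> B - {g}" and "g \<notin> Q"
    and P'Q': "P' \<union> Q' = B - (D \<union> D')" "P' \<inter> Q' = {}" and "g \<notin> Q'"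
    and P': "\<And>a b t. a \<in> P' \<Longrightarrow> b \<in> P' \<Longrightarrow> {a, b, t} \<in> E \<Longrightarrow>
      t \<in> Q' \<union> D \<union> D' \<or> g \<in> {a, b} \<and> t \<in> S"
    and Q': "\<And>a b t. a \<in> Q' \<Longrightarrow> b \<in> Q' \<Longrightarrow> {a, b, t} \<in> E \<Longrightarrow> t \<in> P' \<union> D \<union> D'"
  shows "colouring (S \<union> B) (D \<union> D') (P \<union> P') (Q \<union> Q')"
proof -
  have PQ: "P \<union> Q = S - D" "P \<inter> Q = {}" using col by (auto simp: colouring_def)
  have gSB: "g \<in> S" "g \<in> B" using SB by auto
  have g1: "g \<in> P \<longleftrightarrow> g \<in> P'" using PQ P'Q' gSB D' \<open>g \<notin> Q\<close> \<open>g \<notin> Q'\<close> by blast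
  have g2: "g \<in> Q \<longleftrightarrow> g \<in> Q'" using \<open>g \<notin> Q\<close> \<open>g \<notin> Q'\<close> by blast
  have Q'P': "Q' \<union> P' = B - (D \<union> D')" using P'Q' by blast
  have "(P \<union> P') \<union> (Q \<union> Q') = (S \<union> B) - (D \<union> D')"
  proof -
    have "S \<inter> D' = {}" using D' SB by blast
    moreover have "B \<inter> D \<subseteq> {g}" using D SB by blast
    ultimately show ?thesis using PQ(1) P'Q'(1) by blast
  qed
  moreover have "(P \<union> P') \<inter> (Q \<union> Q') = {}"
  proof -
    have "P \<inter> Q' \<subseteq> {g}" "P' \<inter> Q \<subseteq> {g}" using PQ P'Q' SB by blast+
    then show ?thesis using PQ P'Q' \<open>g \<notin> Q\<close> \<open>g \<notin> Q'\<close> by blast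
  qed
  moreover have "t \<in> (Q \<union> Q') \<union> (D \<union> D')"
    if "a \<in> P \<union> P'" "b \<in> P \<union> P'" "{a, b, t} \<in> E" for a b t
    using colouring_glue_class[OF S B SB col D D' P'Q'(1) g1 g2 P' that] by blast
  moreover have "t \<in> (P \<union> P') \<union> (D \<union> D')"
    if "a \<in> Q \<union> Q'" "b \<in> Q \<union> Q'" "{a, b, t} \<in> E" for a b t
  proof -
    have "t \<in> P' \<union> D \<union> D' \<or> g \<in> {a, b} \<and> t \<in> S"
      if "a \<in> Q'" "b \<in> Q'" "{a, b, t} \<in> E" for a b t
      using Q'[OF that] by blast
    from colouring_glue_class[OF S B SB colouring_commute[OF col] D D' Q'P' g2 g1 this that]
    show ?thesis by blast
  qed
  ultimately show ?thesis unfolding colouring_def by blast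
qed

lemma colouring_gate_not_second:
  assumes "\<exists>P Q. colouring S D P Q"
  obtains P Q where "colouring S D P Q" "g \<notin> Q"
proof -
  obtain P Q where PQ: "colouring S D P Q" using assms by blast
  then have "g \<notin> P \<or> g \<notin> Q" by (auto simp: colouring_def)
  then show thesis using PQ colouring_commute that by blast
qed

lemma colouring_glue_split:
  assumes S: "linearly_connected E S" and B: "linearly_connected E B" and SB: "S \<inter> B = {g}"
    and col: "\<exists>P Q. colouring S D P Q" and D: "D \<subseteq> S" and D': "D' \<subseteq> B - {g}"
    and split: "split_block S g B"
  shows "\<exists>P Q. colouring (S \<union> B) (D \<union> D') P Q"
proof -
  obtain P Q where PQ: "colouring S D P Q" "g \<notin> Q"
    using colouring_gate_not_second[OF col] by blast
  obtain P' Q' where P'Q': "P' \<union> Q' = B" "P' \<inter> Q' = {}" "g \<in> P'"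
    and P': "\<forall>a\<in>P'. \<forall>b\<in>P'. \<forall>t. {a, b, t} \<in> E \<longrightarrow> t \<in> Q' \<or> g \<in> {a, b} \<and> t \<in> S"
    and Q': "\<forall>a\<in>Q'. \<forall>b\<in>Q'. \<forall>t. {a, b, t} \<in> E \<longrightarrow> t \<in> P'"
    using split unfolding split_block_def by (elim exE conjE)
  let ?X = "D \<union> D'"
  \<comment> \<open>Uncolouring further vertices preserves the conditions, so the prescribed
    vertices are simply removed from the block's classes.\<close>
  have "colouring (S \<union> B) ?X (P \<union> (P' - ?X)) (Q \<union> (Q' - ?X))"
  proof (rule colouring_glue[OF S B SB PQ(1) D D' PQ(2)])
    show "(P' - ?X) \<union> (Q' - ?X) = B - ?X" "(P' - ?X) \<inter> (Q' - ?X) = {}" "g \<notin> Q' - ?X"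
      using P'Q' by blast+
    show "t \<in> (Q' - ?X) \<union> D \<union> D' \<or> g \<in> {a, b} \<and> t \<in> S"
      if "a \<in> P' - ?X" "b \<in> P' - ?X" "{a, b, t} \<in> E" for a b t
      using P'[rule_format, of a b t] that by blast
    show "t \<in> (P' - ?X) \<union> D \<union> D'"
      if "a \<in> Q' - ?X" "b \<in> Q' - ?X" "{a, b, t} \<in> E" for a b t
      using Q'[rule_format, of a b t] that by blast
  qed
  then show ?thesis by blast
qed

text \<open>Classes of at most two vertices contain no edge; keeping \<open>g\<close> out of
  \<open>Q\<close> matches the normal form of \<open>colouring_glue\<close>.\<close>

lemma halve_small_set:
  assumes "finite X" "card X \<le> 4"
  obtains P Q where "P \<union> Q = X" "P \<inter> Q = {}" "g \<notin> Q" "card P \<le> 2" "card Q \<le> 2"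
proof (cases "card (X - {g}) \<ge> 2")
  case True
  then obtain Q where Q: "Q \<subseteq> X - {g}" "card Q = 2" "finite Q"
    using obtain_subset_with_card_n by metis
  then have "card (X - Q) \<le> 2"
    using assms by (subst card_Diff_subset) auto
  then show thesis using that[of "X - Q" Q] Q by auto
next
  case False
  have "card (X \<inter> {g}) \<le> 2"
    using card_mono[of "{g}" "X \<inter> {g}"] by simp
  then show thesis using that[of "X \<inter> {g}" "X - {g}"] False by auto
qed

lemma small_set_contains_no_edge:
  assumes "{a, b, t} \<in> E" "a \<in> X" "b \<in> X" "finite X" "card X \<le> 2"
  shows "t \<notin> X"
proof
  assume "t \<in> X"
  then have "card {a, b, t} \<le> card X" using assms by (intro card_mono) auto
  then show False using card_edge[OF assms(1)] assms(5) by simp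
qed

text \<open>One uncoloured vertex leaves at most four to be halved. An edge meeting a closed block
  twice stays inside it, so its third vertex is in the other half or uncoloured.\<close>

lemma colouring_glue_closed:
  assumes S: "linearly_connected E S" and B: "linearly_connected E B" and SB: "S \<inter> B = {g}"
    and col: "\<exists>P Q. colouring S D P Q" and D: "D \<subseteq> S" and D': "D' \<subseteq> B - {g}"
    and closed: "closed_block B" and hit: "(D \<union> D') \<inter> B \<noteq> {}"
  shows "\<exists>P Q. colouring (S \<union> B) (D \<union> D') P Q"
proof -
  obtain P Q where PQ: "colouring S D P Q" "g \<notin> Q"
    using colouring_gate_not_second[OF col] by blast
  have cardB: "card B = 5" and cl: "\<And>a b t. a \<in> B \<Longrightarrow> b \<in> B \<Longrightarrow> {a, b, t} \<in> E \<Longrightarrow> t \<in> B"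
    using closed unfolding closed_block_def by blast+
  have finB: "finite B" using cardB by (intro card_ge_0_finite) simp
  let ?X = "B - (D \<union> D')"
  have "card ?X < card B"
    using hit finB by (intro psubset_card_mono) auto
  then obtain P' Q' where P'Q': "P' \<union> Q' = ?X" "P' \<inter> Q' = {}" "g \<notin> Q'" "card P' \<le> 2" "card Q' \<le> 2"
    using halve_small_set[of ?X g] finB cardB by auto
  have fin: "finite P'" "finite Q'"
    using finB P'Q'(1) by (metis finite_Diff finite_Un)+
  have sub: "P' \<subseteq> B" "Q' \<subseteq> B" using P'Q'(1) by blast+
  have "colouring (S \<union> B) (D \<union> D') (P \<union> P') (Q \<union> Q')"
  proof (rule colouring_glue[OF S B SB PQ(1) D D' PQ(2) P'Q'(1,2,3)])
    show "t \<in> Q' \<union> D \<union> D' \<or> g \<in> {a, b} \<and> t \<in> S" if "a \<in> P'" "b \<in> P'" "{a, b, t} \<in> E" for a b t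
      using small_set_contains_no_edge[OF that(3,1,2) fin(1) P'Q'(4)] cl[OF _ _ that(3)] that sub P'Q'(1)
      by blast
    show "t \<in> P' \<union> D \<union> D'" if "a \<in> Q'" "b \<in> Q'" "{a, b, t} \<in> E" for a b t
      using small_set_contains_no_edge[OF that(3,1,2) fin(2) P'Q'(5)] cl[OF _ _ that(3)] that sub P'Q'(1)
      by blast
  qed
  then show ?thesis by blast
qed

text \<open>Prescribing a set \<open>D\<^sub>0\<close> of uncoloured vertices lets the induction over the blocks, which runs
  from the last block to the first, charge each further uncoloured vertex to a closed block of its
  own.\<close>

definition sparsely_colourable :: "'a set \<Rightarrow> bool" where
  "sparsely_colourable S \<longleftrightarrow> (\<forall>D\<^sub>0\<subseteq>S. \<exists>D. D\<^sub>0 \<subseteq> D \<and> D \<subseteq> S \<and>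
     5 * card (D - D\<^sub>0) \<le> card (S - D\<^sub>0) \<and> (\<exists>P Q. colouring S D P Q))"

lemma sparsely_colourable_singleton: "sparsely_colourable {v}"
proof -
  have "{v, v, t} \<notin> E" for t using edge_distinct(1)[of v v t] by blast
  then have "colouring {v} D ({v} - D) {}" for D
    unfolding colouring_def by blast
  then show ?thesis
    unfolding sparsely_colourable_def by (metis Diff_cancel card.empty mult_0_right order_refl zero_le)
qed

text \<open>If the block splits or \<open>D\<^sub>0\<close> already meets it, the block costs
  nothing. Otherwise \<open>g\<close> joins the set prescribed for \<open>S\<close>, and this extra
  vertex is charged to the five vertices of the closed block.\<close>

lemma sparsely_colourable_glue:
  assumes "finite S" "finite B" and S: "linearly_connected E S" and B: "linearly_connected E B"
    and SB: "S \<inter> B = {g}" and col: "sparsely_colourable S"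
    and block: "split_block S g B \<or> closed_block B"
  shows "sparsely_colourable (S \<union> B)"
  unfolding sparsely_colourable_def
proof (intro allI impI)
  fix D\<^sub>0 assume D\<^sub>0: "D\<^sub>0 \<subseteq> S \<union> B"
  define D' where "D' = D\<^sub>0 - S"
  have D': "D' \<subseteq> B - {g}" using D\<^sub>0 SB by (auto simp: D'_def)
  show "\<exists>D. D\<^sub>0 \<subseteq> D \<and> D \<subseteq> S \<union> B \<and> 5 * card (D - D\<^sub>0) \<le> card (S \<union> B - D\<^sub>0) \<and>
      (\<exists>P Q. colouring (S \<union> B) D P Q)"
  proof (cases "split_block S g B \<or> D\<^sub>0 \<inter> B \<noteq> {}")
    case True
    obtain D where D: "D\<^sub>0 \<inter> S \<subseteq> D" "D \<subseteq> S" "5 * card (D - D\<^sub>0 \<inter> S) \<le> card (S - D\<^sub>0 \<inter> S)"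
        "\<exists>P Q. colouring S D P Q"
      using col unfolding sparsely_colourable_def by (meson Int_lower2)
    have "(D \<union> D') \<inter> B \<noteq> {}" if "D\<^sub>0 \<inter> B \<noteq> {}" using that D(1) D'_def by blast
    then have "\<exists>P Q. colouring (S \<union> B) (D \<union> D') P Q"
      using True block colouring_glue_split[OF S B SB D(4,2) D']
        colouring_glue_closed[OF S B SB D(4,2) D'] by blast
    moreover have "D \<union> D' - D\<^sub>0 = D - D\<^sub>0 \<inter> S" using D(2) D'_def by blast
    moreover have "card (S - D\<^sub>0 \<inter> S) \<le> card (S \<union> B - D\<^sub>0)"
      using assms(1,2) by (intro card_mono) auto
    moreover have "D\<^sub>0 \<subseteq> D \<union> D'" "D \<union> D' \<subseteq> S \<union> B" using D(1,2) D' D'_def by blast+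
    ultimately show ?thesis using D(3) by (intro exI[of _ "D \<union> D'"]) auto
  next
    case False
    then have D\<^sub>0B: "D\<^sub>0 \<inter> B = {}" and closed: "closed_block B" using block by blast+
    have gS: "g \<in> S" "g \<in> B" using SB by auto
    have D\<^sub>0S: "D\<^sub>0 \<subseteq> S" "g \<notin> D\<^sub>0" using D\<^sub>0 D\<^sub>0B gS by blast+
    obtain D where D: "insert g D\<^sub>0 \<subseteq> D" "D \<subseteq> S"
        "5 * card (D - insert g D\<^sub>0) \<le> card (S - insert g D\<^sub>0)" "\<exists>P Q. colouring S D P Q"
      using col gS D\<^sub>0S unfolding sparsely_colourable_def by (meson insert_subsetI)
    have "\<exists>P Q. colouring (S \<union> B) (D \<union> {}) P Q"
      using D(1) gS by (intro colouring_glue_closed[OF S B SB D(4,2) _ closed]) auto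
    moreover have "5 * card (D - D\<^sub>0) \<le> card (S \<union> B - D\<^sub>0)"
    proof -
      have eq: "D - D\<^sub>0 = insert g (D - insert g D\<^sub>0)" using D(1) D\<^sub>0S by blast
      have 1: "card (D - D\<^sub>0) = Suc (card (D - insert g D\<^sub>0))"
        unfolding eq using finite_subset[OF D(2) assms(1)] by (intro card_insert_disjoint) auto
      \<comment> \<open>\<open>g\<close> is taken out of \<open>S\<close> but counted again in
        \<open>B\<close>, so the block contributes exactly five.\<close>
      have "S \<union> B - D\<^sub>0 = (S - insert g D\<^sub>0) \<union> B" "(S - insert g D\<^sub>0) \<inter> B = {}"
        using D\<^sub>0B SB by blast+
      then have "card (S \<union> B - D\<^sub>0) = card (S - insert g D\<^sub>0) + card B"
        using card_Un_disjoint[of "S - insert g D\<^sub>0" B] assms(1,2) by (metis finite_Diff)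
      then show ?thesis using 1 D(3) closed by (simp add: closed_block_def)
    qed
    moreover have "D\<^sub>0 \<subseteq> D" "D \<subseteq> S \<union> B" using D(1,2) by blast+
    ultimately show ?thesis by (intro exI[of _ D]) simp
  qed
qed

section \<open>Maximal sets and their larger colour class\<close>

text \<open>Take a maximal linearly connected, sparsely colourable set; an edge meeting it in one
  vertex would supply a block to glue on.\<close>

lemma exists_closed_colourable_set:
  assumes V: "finite V" "\<Union>E \<subseteq> V" "v \<in> V"
  obtains S where "S \<subseteq> V" "S \<noteq> {}" "sparsely_colourable S"
    "\<And>a b t. a \<in> S \<Longrightarrow> {a, b, t} \<in> E \<Longrightarrow> b \<in> S \<or> t \<in> S"
proof -
  define \<F> where "\<F> = {S. S \<subseteq> V \<and> S \<noteq> {} \<and> linearly_connected E S \<and> sparsely_colourable S}"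
  have "finite \<F>" using V(1) by (simp add: \<F>_def)
  moreover have "{v} \<in> \<F>"
    using V(3) sparsely_colourable_singleton
    by (simp add: \<F>_def linearly_connected_def linked_refl)
  ultimately obtain S where S: "S \<in> \<F>" and max: "\<And>T. T \<in> \<F> \<Longrightarrow> S \<subseteq> T \<Longrightarrow> T = S"
    using finite_has_maximal[of \<F>] by (metis empty_iff)
  have S': "S \<subseteq> V" "S \<noteq> {}" "linearly_connected E S" "sparsely_colourable S"
    using S by (auto simp: \<F>_def)
  have "b \<in> S \<or> t \<in> S" if a: "a \<in> S" and e: "{a, b, t} \<in> E" for a b t
  proof (rule ccontr)
    assume "\<not> ?thesis"
    then have "S \<inter> {a, b, t} = {a}" using a by blast
    then obtain B where B: "attachable S a B"
      using exists_attachable[OF S'(3) _ e] by blast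
    have BV: "B \<subseteq> V" "S \<inter> B = {a}" "B \<noteq> {a}" using V(2) B unfolding attachable_def by blast+
    have fin: "finite S" "finite B" using S'(1) BV(1) V(1) finite_subset by blast+
    have "linearly_connected E B" "split_block S a B \<or> closed_block B"
      using B by (auto simp: attachable_def)
    then have "S \<union> B \<in> \<F>"
      using linearly_connected_glue[OF S'(3) _ BV(2)]
        sparsely_colourable_glue[OF fin S'(3) _ BV(2) S'(4)] S'(1,2) BV(1) by (simp add: \<F>_def)
    then have "S \<union> B = S" using max by blast
    then show False using BV(2,3) by blast
  qed
  then show thesis using that S' by blast
qed

text \<open>\<open>Y\<close> is the larger class of a colouring with at most a fifth of
  \<open>S\<close> uncoloured, hence at least half of the other four fifths. By the last conclusion
  no edge meeting \<open>Y\<close> fits into the union of \<open>Y\<close> and a set outside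
  \<open>S\<close>.\<close>

lemma exists_removable_set:
  assumes V: "finite V" "\<Union>E \<subseteq> V" "V \<noteq> {}"
  obtains S Y where "S \<subseteq> V" "S \<noteq> {}" "Y \<subseteq> S" "2 * card S \<le> 5 * card Y"
    "\<And>a b t. a \<in> Y \<Longrightarrow> {a, b, t} \<in> E \<Longrightarrow> b \<in> S - Y \<or> t \<in> S - Y"
proof -
  obtain v where "v \<in> V" using V(3) by blast
  then obtain S where S: "S \<subseteq> V" "S \<noteq> {}" "sparsely_colourable S"
      "\<And>a b t. a \<in> S \<Longrightarrow> {a, b, t} \<in> E \<Longrightarrow> b \<in> S \<or> t \<in> S"
    using exists_closed_colourable_set[OF V(1,2)] by metis
  obtain D where D: "D \<subseteq> S" "5 * card D \<le> card S" "\<exists>P Q. colouring S D P Q"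
    using S(3)[unfolded sparsely_colourable_def, rule_format, of "{}"] by auto
  obtain P Q where PQ: "colouring S D P Q" "card Q \<le> card P"
    using D(3) colouring_commute by (meson nle_le)
  have P: "P \<union> Q = S - D" "P \<inter> Q = {}"
      "\<And>a b t. a \<in> P \<Longrightarrow> b \<in> P \<Longrightarrow> {a, b, t} \<in> E \<Longrightarrow> t \<in> Q \<union> D"
    using PQ(1) by (auto simp: colouring_def)
  have fin: "finite S" using S(1) V(1) finite_subset by blast
  have "card (P \<union> Q) = card S - card D"
    using P(1) D(1) fin by (metis card_Diff_subset finite_subset)
  moreover have "card (P \<union> Q) = card P + card Q"
    using P(1,2) fin by (metis card_Un_disjoint finite_Diff finite_Un)
  ultimately have "2 * card S \<le> 5 * card P" using PQ(2) D(2) by linarith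
  moreover have "b \<in> S - P \<or> t \<in> S - P" if a: "a \<in> P" and e: "{a, b, t} \<in> E" for a b t
  proof (rule ccontr)
    assume *: "\<not> ?thesis"
    have QD: "Q \<union> D \<subseteq> S - P" using P(1,2) D(1) by blast
    \<comment> \<open>A second vertex of the edge lies in \<open>S\<close>, hence by
      \<open>*\<close> in \<open>P\<close>; the pair of one colour then forces the third vertex into
      \<open>Q \<union> D\<close>, contrary to \<open>*\<close>.\<close>
    have "b \<in> P \<or> t \<in> P" using S(4)[OF _ e] a P(1) * by blast
    then show False
      using P(3)[OF a _ e] P(3)[OF a, of t b] e QD * by (auto simp: insert_commute)
  qed
  moreover have "P \<subseteq> S" using P(1) by blast
  ultimately show thesis using that[of S P] S(1,2) by blast
qed

end

section \<open>Induction on the number of vertices\<close>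

lemma linear_cycle_free_subset:
  "linear_cycle_free E \<Longrightarrow> F \<subseteq> E \<Longrightarrow> linear_cycle_free F"
  unfolding linear_cycle_free_def has_linear_cycle_def by blast

text \<open>The bound is additive: \<open>Y\<close> pays for \<open>S\<close>, the induction
  hypothesis for \<open>V - S\<close>.\<close>

lemma large_independent_set:
  assumes "finite V" "linear_cycle_free E" "\<Union>E \<subseteq> V"
  shows "\<exists>I. independent_set V E I \<and> 2 * card V \<le> 5 * card I"
  using assms
proof (induction "card V" arbitrary: V E rule: less_induct)
  case less
  interpret linear_cycle_free E by (rule less.prems(2))
  show ?case
  proof (cases "V = {}")
    case True
    have "e \<noteq> {}" if "e \<in> E" for e using card_edge[OF that] by auto
    then show ?thesis
      using True by (intro exI[of _ "{}"]) (auto simp: independent_set_def)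
  next
    case False
    obtain S Y where S: "S \<subseteq> V" "S \<noteq> {}" "Y \<subseteq> S" "2 * card S \<le> 5 * card Y"
        and Y: "\<And>a b t. a \<in> Y \<Longrightarrow> {a, b, t} \<in> E \<Longrightarrow> b \<in> S - Y \<or> t \<in> S - Y"
      using exists_removable_set[OF less.prems(1,3) False] by metis
    have finS: "finite S" using S(1) less.prems(1) finite_subset by blast
    have card_V: "card (V - S) = card V - card S" "card S \<le> card V" "card S > 0"
      using S(1,2) finS less.prems(1) by (auto simp: card_Diff_subset card_mono card_gt_0_iff)
    define F where "F = {e \<in> E. e \<subseteq> V - S}"
    have "linear_cycle_free F" "\<Union>F \<subseteq> V - S"
      using linear_cycle_free_subset[OF less.prems(2)] by (auto simp: F_def)
    then obtain I where I: "independent_set (V - S) F I" "2 * card (V - S) \<le> 5 * card I"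
      using less.hyps[of "V - S" F] card_V less.prems(1) by auto
    have IS: "I \<subseteq> V - S" and ind: "\<And>e. e \<in> F \<Longrightarrow> \<not> e \<subseteq> I"
      using I(1) by (auto simp: independent_set_def)
    have "\<not> e \<subseteq> I \<union> Y" if e: "e \<in> E" for e
    proof
      assume sub: "e \<subseteq> I \<union> Y"
      show False
      proof (cases "e \<inter> Y = {}")
        case True
        then have "e \<subseteq> I" using sub by blast
        then show False using ind[of e] e IS by (auto simp: F_def)
      next
        case False
        then obtain a where a: "a \<in> e" "a \<in> Y" by blast
        then have "card (e - {a}) = 2" using card_edge[OF e] by simp
        then obtain b t where "e - {a} = {b, t}" by (auto simp: card_2_iff)
        then have "e = {a, b, t}" using a(1) by blast
        then show False using Y[OF a(2), of b t] e sub IS by blast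
      qed
    qed
    then have "independent_set V E (I \<union> Y)"
      using IS S(1,3) by (auto simp: independent_set_def)
    moreover have "card (I \<union> Y) = card I + card Y"
    proof (rule card_Un_disjoint)
      show "finite I" "finite Y" using IS S(3) finS less.prems(1) finite_subset by blast+
    qed (use IS S(3) in blast)
    ultimately show ?thesis
      using I(2) S(4) card_V by (intro exI[of _ "I \<union> Y"]) simp
  qed
qed

theorem theorem1p5:
  fixes V :: "'a set" and E :: "'a set set" and n :: nat
  assumes "finite V" and "card V = n"
    and "three_uniform_hypergraph V E"
    and "\<not> has_linear_cycle E"
  shows "real (independence_number V E) \<ge> 2 / 5 * real n"
proof -
  have "linear_cycle_free E" "\<Union>E \<subseteq> V"
    using assms(3,4) by (auto simp: linear_cycle_free_def three_uniform_hypergraph_def)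
  then obtain I where I: "independent_set V E I" "2 * card V \<le> 5 * card I"
    using large_independent_set[OF assms(1)] by blast
  have "{card S |S. independent_set V E S} \<subseteq> card ` Pow V"
    by (auto simp: independent_set_def)
  then have "finite {card S |S. independent_set V E S}"
    using assms(1) by (simp add: finite_subset)
  then have "card I \<le> independence_number V E"
    unfolding independence_number_def using I(1) by (intro Max_ge) auto
  then show ?thesis using I(2) assms(2) by simp
qed

end
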